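(* Let $m,n,r$ be positive integers with $r<\min\{m,n\}$ and let $f:\mathbb{R}^{m\times n}\to\mathbb{R}$ be differentiable with locally Lipschitz continuous gradient. Let $X\in\mathbb{R}^{m\times n}$ with $\underline{r}:=\operatorname{rank}X<r$. Let $\mathcal{C}\subseteq\mathbb{R}^{m\times n}_{\le r-\underline{r}}$ be a closed cone such that $\mathcal{C}^*=\{0_{m\times n}\}$. Then every $G\in P_{\mathcal{C}}(-\nabla f(X))$ satisfies $$\langle G,-\nabla f(X)\rangle\ge\max\{\kappa_1\,\mathrm{s}(X;f,\mathbb{R}^{m\times n}_{\le r})^2,\ \kappa_2\|G\|^2\}$$ with $\kappa_1=\min_{Y\in\mathbb{R}^{m\times n},\,\|Y\|=1}\|P_{\mathcal{C}}(Y)\|^2$ and $\kappa_2=1$, and $X+\alpha G\in\mathbb{R}^{m\times n}_{\le r}$ for all $\alpha\in(0,\infty)$.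
   Context: $\mathbb{R}^{m\times n}$ carries the Frobenius inner product $\langle X,Y\rangle=\operatorname{tr}(Y^\top X)$ and Frobenius norm $\|\cdot\|$; $0_{m\times n}$ is the zero matrix. $\mathbb{R}^{m\times n}_{\le q}=\{X:\operatorname{rank}X\le q\}$. Locally Lipschitz continuous gradient means $\nabla f$ is Lipschitz on every closed ball. A cone is a nonempty set $\mathcal{C}\subseteq\mathbb{R}^{m\times n}$ with $\alpha X\in\mathcal{C}$ for all $X\in\mathcal{C}$, $\alpha\in[0,\infty)$ (not necessarily convex). Its polar is $\mathcal{C}^*=\{Y\in\mathbb{R}^{m\times n}:\langle X,Y\rangle\le0\ \forall X\in\mathcal{C}\}$. For nonempty $\mathcal{S}\subseteq\mathbb{R}^{m\times n}$, $P_{\mathcal{S}}(X)=\operatorname{argmin}_{Y\in\mathcal{S}}\|X-Y\|$ (a set, nonempty if $\mathcal{S}$ is closed). For a closed cone $\mathcal{C}$, all elements of $P_{\mathcal{C}}(X)$ have the same norm, denoted $\|P_{\mathcal{C}}(X)\|$. Tangent cone: for $X\in\mathcal{S}$, $T_{\mathcal{S}}(X)$ is the set of all $Z$ for which there are sequences $(X_i)$ in $\mathcal{S}$ converging to $X$ and $(t_i)$ in $(0,\infty)$ with $(X_i-X)/t_i\to Z$; it is a closed cone. $\mathrm{s}(X;f,\mathbb{R}^{m\times n}_{\le r})=\|P_{T_{\mathbb{R}^{m\times n}_{\le r}}(X)}(-\nabla f(X))\|$. *)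

theory Defs
  imports "HOL-Analysis.Analysis"
begin

text \<open>
  An \<open>m \<times> n\<close> real matrix is an element of \<open>real ^ 'n ^ 'm\<close> with \<open>m = CARD('m)\<close> and
  \<open>n = CARD('n)\<close>. The inner product and norm that HOL-Analysis puts on this type are the
  Frobenius ones:
\<close>

lemma inner_matrix_eq_trace:
  fixes X Y :: "real ^ 'n ^ 'm"
  shows "inner X Y = trace (transpose Y ** X)"
  unfolding inner_vec_def trace_def matrix_matrix_mult_def transpose_def
  by (simp add: mult.commute) (rule sum.swap)

definition rank_le :: "nat \<Rightarrow> (real ^ 'n ^ 'm) set" where
  "rank_le q = {X. rank X \<le> q}"

text \<open>The gradient is meaningful wherever \<open>f\<close> is differentiable; see
  \<open>gderiv_gradient\<close> below.\<close>

definition gradient :: "('a::real_inner \<Rightarrow> real) \<Rightarrow> 'a \<Rightarrow> 'a" where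
  "gradient f x = (THE D. GDERIV f x :> D)"

definition locally_lipschitz_gradient :: "('a::real_inner \<Rightarrow> real) \<Rightarrow> bool" where
  "locally_lipschitz_gradient f \<longleftrightarrow>
     (\<forall>z \<rho>. \<exists>L. L-lipschitz_on (cball z \<rho>) (gradient f))"

text \<open>The library predicate \<open>cone\<close> also holds of the empty set.\<close>

definition closed_cone :: "'a::real_normed_vector set \<Rightarrow> bool" where
  "closed_cone C \<longleftrightarrow> C \<noteq> {} \<and> cone C \<and> closed C"

definition polar :: "'a::real_inner set \<Rightarrow> 'a set" where
  "polar C = {Y. \<forall>X\<in>C. inner X Y \<le> 0}"

definition metric_proj :: "'a::real_normed_vector set \<Rightarrow> 'a \<Rightarrow> 'a set" where
  "metric_proj S X = {Y. is_arg_min (\<lambda>Y. norm (X - Y)) (\<lambda>Y. Y \<in> S) Y}"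

text \<open>The common norm of all elements of \<open>metric_proj C X\<close>, for a closed cone \<open>C\<close>; see
  \<open>proj_norm_eq\<close> below. Nothing is intended for other sets.\<close>

definition proj_norm :: "'a::real_normed_vector set \<Rightarrow> 'a \<Rightarrow> real" where
  "proj_norm C X = the_elem (norm ` metric_proj C X)"

definition tangent_cone :: "'a::real_normed_vector set \<Rightarrow> 'a \<Rightarrow> 'a set" where
  "tangent_cone S X =
     {Z. \<exists>(x :: nat \<Rightarrow> 'a) (t :: nat \<Rightarrow> real).
           (\<forall>i. x i \<in> S) \<and> x \<longlonglongrightarrow> X \<and> (\<forall>i. 0 < t i) \<and>
           (\<lambda>i. (x i - X) /\<^sub>R t i) \<longlonglongrightarrow> Z}"

text \<open>The stationarity measure \<open>s(X; f, rank_le q)\<close>.\<close>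

definition stat_measure :: "(real ^ 'n ^ 'm) \<Rightarrow> ((real ^ 'n ^ 'm) \<Rightarrow> real) \<Rightarrow> nat \<Rightarrow> real" where
  "stat_measure X f q = proj_norm (tangent_cone (rank_le q) X) (- gradient f X)"

text \<open>\<open>v\<close> is the (attained) minimum of \<open>g\<close> on \<open>S\<close>.\<close>

definition is_minimum_on :: "('a \<Rightarrow> real) \<Rightarrow> 'a set \<Rightarrow> real \<Rightarrow> bool" where
  "is_minimum_on g S v \<longleftrightarrow> v \<in> g ` S \<and> (\<forall>y\<in>S. v \<le> g y)"


lemma gderiv_gradient:
  fixes f :: "'a::euclidean_space \<Rightarrow> real"
  assumes "f differentiable (at x)"
  shows "GDERIV f x :> gradient f x"
proof -
  obtain f' where f': "(f has_derivative f') (at x)"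
    using assms by (auto simp: differentiable_def)
  have lin: "linear f'"
    using f' has_derivative_linear by blast
  have "f' = (\<lambda>h. inner h (adjoint f' 1))"
    using adjoint_works[OF lin, of _ "1::real"] by (auto simp: fun_eq_iff)
  then have D: "GDERIV f x :> adjoint f' 1"
    using f' by (simp add: gderiv_def)
  have "D' = adjoint f' 1" if "GDERIV f x :> D'" for D'
  proof -
    have "(\<lambda>h. inner h D') = (\<lambda>h. inner h (adjoint f' 1))"
      using that D has_derivative_unique unfolding gderiv_def by blast
    then show ?thesis
      by (metis vector_eq_ldot)
  qed
  with D show ?thesis
    unfolding gradient_def by (rule theI)
qed

lemma inner_metric_proj_cone:
  fixes C :: "'a::real_inner set"
  assumes "cone C" and Y: "Y \<in> metric_proj C X"
  shows "inner X Y = (norm Y)\<^sup>2"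
proof (cases "Y = 0")
  case False
  define a b where "a = inner Y Y" and "b = inner X Y"
  have a: "a > 0" using False by (simp add: a_def)
  have "Y \<in> C" using Y by (simp add: metric_proj_def is_arg_min_def)
  have *: "a - 2 * b \<le> c * c * a - 2 * c * b" if "c \<ge> 0" for c
  proof -
    have "c *\<^sub>R Y \<in> C" using assms(1) \<open>Y \<in> C\<close> that by (simp add: cone_def)
    then have "norm (X - Y) \<le> norm (X - c *\<^sub>R Y)"
      using Y by (auto simp: metric_proj_def is_arg_min_def not_less)
    then have "inner (X - Y) (X - Y) \<le> inner (X - c *\<^sub>R Y) (X - c *\<^sub>R Y)"
      by (simp add: norm_le)
    then show ?thesis
      by (simp add: inner_diff_left inner_diff_right inner_commute a_def b_def algebra_simps)
  qed
  have b: "b \<ge> 0" using *[of 0] a by simp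
  have "a - 2 * b \<le> - (b * b / a)"
    using *[of "b / a"] a b by (simp add: field_simps)
  then have "(a - b) * (a - b) \<le> 0"
    using a by (simp add: field_simps)
  then have "a = b"
    by (metis eq_iff_diff_eq_0 mult_eq_0_iff order_antisym zero_le_square)
  then show ?thesis by (simp add: a_def b_def power2_norm_eq_inner)
qed simp

lemma proj_norm_eq:
  fixes C :: "'a::real_inner set"
  assumes "cone C" and Y: "Y \<in> metric_proj C X"
  shows "proj_norm C X = norm Y"
proof -
  have "norm Z = norm Y" if Z: "Z \<in> metric_proj C X" for Z
  proof -
    have "norm (X - Z) = norm (X - Y)"
      using Y Z by (auto simp: metric_proj_def is_arg_min_def not_less intro: order_antisym)
    then have "(norm (X - Z))\<^sup>2 = (norm (X - Y))\<^sup>2" by simp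
    then have "(norm Z)\<^sup>2 = (norm Y)\<^sup>2"
      using inner_metric_proj_cone[OF assms(1) Y] inner_metric_proj_cone[OF assms(1) Z]
      by (simp add: power2_norm_eq_inner inner_diff_left inner_diff_right inner_commute)
    then show ?thesis by simp
  qed
  then have "norm ` metric_proj C X = {norm Y}" using Y by blast
  then show ?thesis by (simp add: proj_norm_def)
qed

end

theory Submission
  imports Defs
begin

text \<open>
  Write \<open>N = - gradient f X\<close>. For a closed cone \<open>C\<close>, the projection of a point onto \<open>C\<close> is in
  particular its projection onto a ray, so Pythagoras gives
  \<open>(proj_norm C Y)\<^sup>2 = (norm Y)\<^sup>2 - (infdist Y C)\<^sup>2\<close>
  (\<open>proj_norm_pythagoras\<close>). The right-hand side is continuous in \<open>Y\<close>, so \<open>proj_norm C\<close> attains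
  a minimum on the unit sphere, whose square is \<open>\<kappa>\<^sub>1\<close>. The norm of the projection is also positively
  homogeneous, whence \<open>\<kappa>\<^sub>1 * (norm N)\<^sup>2 \<le> (norm G)\<^sup>2 = inner G N\<close> for every projection \<open>G\<close> of \<open>N\<close>
  (\<open>proj_norm_sphere_bound\<close>).

  The stationarity measure is itself the norm of a projection of \<open>N\<close> onto a closed cone, the
  tangent cone of \<open>rank_le r\<close>, and projecting onto a cone never increases the norm; so it is at
  most \<open>norm N\<close>, and the bound in terms of \<open>norm N\<close> implies the claimed one because
  \<open>\<kappa>\<^sub>1 \<ge> 0\<close>. Finally, \<open>X + \<alpha> *\<^sub>R G\<close> stays in \<open>rank_le r\<close> because \<open>\<alpha> *\<^sub>R G\<close> lies in \<open>C\<close>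
  and the rank is subadditive.
\<close>

section \<open>Projection onto a closed cone\<close>

lemma metric_proj_iff:
  "Y \<in> metric_proj S X \<longleftrightarrow> Y \<in> S \<and> (\<forall>Z\<in>S. norm (X - Y) \<le> norm (X - Z))"
  by (auto simp: metric_proj_def is_arg_min_def not_less)

lemma metric_proj_nonempty:
  fixes S :: "'a::euclidean_space set"
  assumes "closed S" "S \<noteq> {}"
  shows "\<exists>Y. Y \<in> metric_proj S X"
proof -
  obtain Y where "Y \<in> S" "\<And>Z. Z \<in> S \<Longrightarrow> dist X Y \<le> dist X Z"
    using distance_attains_inf[OF assms, of X] by blast
  then show ?thesis
    by (intro exI[of _ Y]) (simp add: metric_proj_iff dist_norm)
qed

lemma norm_metric_proj_eq_infdist:
  assumes "Y \<in> metric_proj S X"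
  shows "norm (X - Y) = infdist X S"
proof (rule antisym)
  have "Y \<in> S" using assms by (simp add: metric_proj_iff)
  then show "infdist X S \<le> norm (X - Y)"
    by (metis dist_norm infdist_le)
  show "norm (X - Y) \<le> infdist X S"
    using assms \<open>Y \<in> S\<close>
    by (auto simp: infdist_def metric_proj_iff dist_norm intro!: cINF_greatest)
qed

text \<open>The residual \<open>X - Y\<close> is orthogonal to the projection \<open>Y\<close>, because \<open>Y\<close> is also the best
  approximation of \<open>X\<close> on its own ray.\<close>

lemma proj_norm_pythagoras:
  fixes C :: "'a::euclidean_space set"
  assumes "closed_cone C"
  shows "(proj_norm C X)\<^sup>2 = (norm X)\<^sup>2 - (infdist X C)\<^sup>2"
proof -
  have C: "cone C" "closed C" "C \<noteq> {}" using assms by (auto simp: closed_cone_def)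
  obtain Y where Y: "Y \<in> metric_proj C X"
    using metric_proj_nonempty C by blast
  have "inner X Y = (norm Y)\<^sup>2" by (rule inner_metric_proj_cone[OF C(1) Y])
  then have "(norm (X - Y))\<^sup>2 = (norm X)\<^sup>2 - (norm Y)\<^sup>2"
    by (simp add: power2_norm_eq_inner inner_diff_left inner_diff_right inner_commute)
  then show ?thesis
    using norm_metric_proj_eq_infdist[OF Y] proj_norm_eq[OF C(1) Y] by simp
qed

lemma proj_norm_le_norm:
  fixes C :: "'a::euclidean_space set"
  assumes "closed_cone C"
  shows "(proj_norm C X)\<^sup>2 \<le> (norm X)\<^sup>2"
  by (simp add: proj_norm_pythagoras[OF assms])

lemma metric_proj_scale:
  assumes "cone C" and c: "c > 0" and Y: "Y \<in> metric_proj C X"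
  shows "c *\<^sub>R Y \<in> metric_proj C (c *\<^sub>R X)"
  unfolding metric_proj_iff
proof (intro conjI ballI)
  show "c *\<^sub>R Y \<in> C" using assms by (simp add: metric_proj_iff cone_def)
  fix Z assume "Z \<in> C"
  then have "inverse c *\<^sub>R Z \<in> C" using assms(1) c by (simp add: cone_def)
  then have "c * norm (X - Y) \<le> c * norm (X - inverse c *\<^sub>R Z)"
    using Y c by (simp add: metric_proj_iff)
  moreover have "c * norm W = norm (c *\<^sub>R W)" for W :: 'a
    using c by simp
  ultimately show "norm (c *\<^sub>R X - c *\<^sub>R Y) \<le> norm (c *\<^sub>R X - Z)"
    using c by (simp add: scaleR_diff_right del: norm_scaleR)
qed

lemma proj_norm_sphere_minimum:
  fixes C :: "'a::euclidean_space set"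
  assumes "closed_cone C"
  shows "\<exists>\<kappa>. is_minimum_on (\<lambda>Y. (proj_norm C Y)\<^sup>2) {Y. norm Y = 1} \<kappa>"
proof -
  have "continuous_on (sphere 0 1) (\<lambda>Y. (proj_norm C Y)\<^sup>2)"
    unfolding proj_norm_pythagoras[OF assms] by (intro continuous_intros)
  moreover have "sphere (0::'a) 1 \<noteq> {}" by simp
  ultimately obtain Y where "Y \<in> sphere 0 1"
      "\<And>Z. Z \<in> sphere 0 1 \<Longrightarrow> (proj_norm C Y)\<^sup>2 \<le> (proj_norm C Z)\<^sup>2"
    using continuous_attains_inf[OF compact_sphere] by metis
  then show ?thesis
    unfolding is_minimum_on_def by (intro exI[of _ "(proj_norm C Y)\<^sup>2"]) auto
qed

lemma proj_norm_sphere_bound: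
  fixes C :: "'a::real_inner set"
  assumes "cone C" and G: "G \<in> metric_proj C X"
    and \<kappa>: "\<And>Y. norm Y = 1 \<Longrightarrow> \<kappa> \<le> (proj_norm C Y)\<^sup>2"
  shows "\<kappa> * (norm X)\<^sup>2 \<le> (norm G)\<^sup>2"
proof (cases "X = 0")
  case False
  define c where "c = inverse (norm X)"
  have c: "c > 0" using False by (simp add: c_def)
  have "\<kappa> \<le> (proj_norm C (c *\<^sub>R X))\<^sup>2"
    using False by (intro \<kappa>) (simp add: c_def)
  also have "\<dots> = (norm G)\<^sup>2 / (norm X)\<^sup>2"
    using proj_norm_eq[OF assms(1) metric_proj_scale[OF assms(1) c G]]
    by (simp add: c_def field_simps)
  finally show ?thesis using False by (simp add: field_simps)
qed simp

section \<open>The tangent cone is a closed cone\<close>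

text \<open>Replacing the sequences by a condition for each \<open>\<epsilon>\<close> performs the diagonal argument
  once: closedness becomes a triangle inequality.\<close>

lemma tangent_cone_iff:
  "Z \<in> tangent_cone S X \<longleftrightarrow>
    (\<forall>\<epsilon>>0. \<exists>Y\<in>S. \<exists>t>0. norm (Y - X) < \<epsilon> \<and> norm ((Y - X) /\<^sub>R t - Z) < \<epsilon>)"
    (is "_ \<longleftrightarrow> ?approx")
proof
  assume "Z \<in> tangent_cone S X"
  then obtain x t where x: "\<And>i. x i \<in> S" "x \<longlonglongrightarrow> X" and t: "\<And>i. 0 < t i"
    and lim: "(\<lambda>i. (x i - X) /\<^sub>R t i) \<longlonglongrightarrow> Z"
    unfolding tangent_cone_def by blast
  show ?approx
  proof (intro allI impI)
    fix \<epsilon> :: real assume "\<epsilon> > 0"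
    have "\<forall>\<^sub>F i in sequentially. norm (x i - X) < \<epsilon> \<and> norm ((x i - X) /\<^sub>R t i - Z) < \<epsilon>"
      using tendstoD[OF x(2) \<open>\<epsilon> > 0\<close>] tendstoD[OF lim \<open>\<epsilon> > 0\<close>]
      by (auto simp: dist_norm intro: eventually_conj)
    then obtain i where "norm (x i - X) < \<epsilon> \<and> norm ((x i - X) /\<^sub>R t i - Z) < \<epsilon>"
      by (metis (no_types, lifting) eventually_sequentially order_refl)
    then show "\<exists>Y\<in>S. \<exists>t>0. norm (Y - X) < \<epsilon> \<and> norm ((Y - X) /\<^sub>R t - Z) < \<epsilon>"
      using x(1) t by blast
  qed
next
  assume approx: ?approx
  have "\<exists>Y t. Y \<in> S \<and> t > 0 \<and> norm (Y - X) < inverse (real (Suc i)) \<and>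
      norm ((Y - X) /\<^sub>R t - Z) < inverse (real (Suc i))" for i
    using approx[rule_format, of "inverse (real (Suc i))"] by auto
  then obtain x t where xt: "\<And>i. x i \<in> S" "\<And>i. 0 < t i"
      "\<And>i. norm (x i - X) < inverse (real (Suc i))"
      "\<And>i. norm ((x i - X) /\<^sub>R t i - Z) < inverse (real (Suc i))"
    by metis
  have "(\<lambda>i. x i - X) \<longlonglongrightarrow> 0"
    by (rule Lim_null_comparison[OF _ LIMSEQ_inverse_real_of_nat])
       (intro always_eventually allI less_imp_le xt(3))
  moreover have "(\<lambda>i. (x i - X) /\<^sub>R t i - Z) \<longlonglongrightarrow> 0"
    by (rule Lim_null_comparison[OF _ LIMSEQ_inverse_real_of_nat])
       (intro always_eventually allI less_imp_le xt(4))
  ultimately show "Z \<in> tangent_cone S X"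
    unfolding tangent_cone_def using xt(1,2)
    by (auto dest!: LIM_zero_cancel intro!: exI[of _ x] exI[of _ t])
qed

lemma closed_tangent_cone: "closed (tangent_cone S X)"
proof -
  have "Z \<in> tangent_cone S X" if near: "\<forall>e>0. \<exists>W\<in>tangent_cone S X. dist W Z < e" for Z
    unfolding tangent_cone_iff
  proof (intro allI impI)
    fix \<epsilon> :: real assume "\<epsilon> > 0"
    then obtain W where W: "W \<in> tangent_cone S X" "norm (W - Z) < \<epsilon> / 2"
      using near[rule_format, of "\<epsilon> / 2"] by (auto simp: dist_norm)
    then obtain Y t where Y: "Y \<in> S" "t > 0" "norm (Y - X) < \<epsilon> / 2"
        "norm ((Y - X) /\<^sub>R t - W) < \<epsilon> / 2"
      using W(1)[unfolded tangent_cone_iff, rule_format, of "\<epsilon> / 2"] \<open>\<epsilon> > 0\<close> by auto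
    have "norm ((Y - X) /\<^sub>R t - Z) < \<epsilon>"
      using norm_triangle_ineq[of "(Y - X) /\<^sub>R t - W" "W - Z"] Y(4) W(2) by simp
    then show "\<exists>Y\<in>S. \<exists>t>0. norm (Y - X) < \<epsilon> \<and> norm ((Y - X) /\<^sub>R t - Z) < \<epsilon>"
      using Y \<open>\<epsilon> > 0\<close> by (intro bexI[of _ Y] exI[of _ t]) auto
  qed
  then show ?thesis
    by (auto simp: closure_approachable simp flip: closure_subset_eq)
qed

lemma closed_cone_tangent_cone:
  assumes "X \<in> S"
  shows "closed_cone (tangent_cone S X)"
proof -
  have zero: "0 \<in> tangent_cone S X"
    unfolding tangent_cone_iff using assms by (auto intro!: bexI[of _ X] exI[of _ 1])
  have "c *\<^sub>R Z \<in> tangent_cone S X" if Z: "Z \<in> tangent_cone S X" and c: "c > 0" for Z c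
  proof -
    obtain x t where x: "\<And>i. x i \<in> S" "x \<longlonglongrightarrow> X" and t: "\<And>i. 0 < t i"
      and lim: "(\<lambda>i. (x i - X) /\<^sub>R t i) \<longlonglongrightarrow> Z"
      using Z unfolding tangent_cone_def by blast
    have "(\<lambda>i. (x i - X) /\<^sub>R (t i / c)) \<longlonglongrightarrow> c *\<^sub>R Z"
      using tendsto_scaleR[OF tendsto_const[of c] lim] by (simp add: divide_inverse mult.commute)
    moreover have "\<forall>i. 0 < t i / c" using t c by simp
    ultimately show ?thesis
      unfolding tangent_cone_def using x
      by (auto intro!: exI[of _ x] exI[of _ "\<lambda>i. t i / c"])
  qed
  then have "cone (tangent_cone S X)"
    unfolding cone_def using zero by (metis order_le_less scaleR_zero_left)
  then show ?thesis
    unfolding closed_cone_def using zero closed_tangent_cone by blast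
qed

section \<open>Subadditivity of the rank\<close>

lemma rank_add_le:
  fixes A B :: "real ^ 'n ^ 'm"
  shows "rank (A + B) \<le> rank A + rank B"
proof -
  let ?R = "\<lambda>M :: real ^ 'n ^ 'm. range (\<lambda>x. M *v x)"
  have sub: "subspace (?R M)" for M
    by (intro linear_subspace_image matrix_vector_mul_linear subspace_UNIV)
  have "rank (A + B) = dim (?R (A + B))" by (rule rank_dim_range)
  also have "\<dots> \<le> dim {x + y |x y. x \<in> ?R A \<and> y \<in> ?R B}"
    by (rule dim_subset) (auto simp: matrix_vector_mult_add_rdistrib)
  also have "\<dots> \<le> dim (?R A) + dim (?R B)"
    using dim_sums_Int[OF sub sub, of A B] by linarith
  finally show ?thesis by (simp add: rank_dim_range)
qed

section \<open>The gradient bound for projections onto a cone of low-rank matrices\<close>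

theorem proposition6p2:
  fixes f :: "real ^ 'n ^ 'm \<Rightarrow> real"
    and X :: "real ^ 'n ^ 'm"
    and C :: "(real ^ 'n ^ 'm) set"
    and r :: nat
  assumes "0 < r" and "r < min CARD('m) CARD('n)"
    and "\<And>Y. f differentiable (at Y)"
    and "locally_lipschitz_gradient f"
    and "rank X < r"
    and "closed_cone C"
    and "C \<subseteq> rank_le (r - rank X)"
    and "polar C = {0}"
  shows "\<exists>\<kappa>\<^sub>1. is_minimum_on (\<lambda>Y. (proj_norm C Y)\<^sup>2) {Y. norm Y = 1} \<kappa>\<^sub>1 \<and>
    (\<forall>G \<in> metric_proj C (- gradient f X).
       inner G (- gradient f X) \<ge> max (\<kappa>\<^sub>1 * (stat_measure X f r)\<^sup>2) (1 * (norm G)\<^sup>2) \<and>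
       (\<forall>\<alpha>>0. X + \<alpha> *\<^sub>R G \<in> rank_le r))"
proof -
  define N where "N = - gradient f X"
  have cone: "cone C" using \<open>closed_cone C\<close> by (simp add: closed_cone_def)
  obtain \<kappa> where min: "is_minimum_on (\<lambda>Y. (proj_norm C Y)\<^sup>2) {Y. norm Y = 1} \<kappa>"
    using proj_norm_sphere_minimum[OF \<open>closed_cone C\<close>] by blast
  have \<kappa>_le: "\<kappa> \<le> (proj_norm C Y)\<^sup>2" if "norm Y = 1" for Y
    using min that by (simp add: is_minimum_on_def)
  have "\<kappa> \<ge> 0" using min by (auto simp: is_minimum_on_def)
  have "X \<in> rank_le r" using \<open>rank X < r\<close> by (simp add: rank_le_def)
  then have stat: "(stat_measure X f r)\<^sup>2 \<le> (norm N)\<^sup>2"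
    unfolding stat_measure_def N_def by (intro proj_norm_le_norm closed_cone_tangent_cone)
  have "max (\<kappa> * (stat_measure X f r)\<^sup>2) (1 * (norm G)\<^sup>2) \<le> inner G N \<and>
      (\<forall>\<alpha>>0. X + \<alpha> *\<^sub>R G \<in> rank_le r)" if G: "G \<in> metric_proj C N" for G
  proof (intro conjI allI impI)
    have "\<kappa> * (stat_measure X f r)\<^sup>2 \<le> \<kappa> * (norm N)\<^sup>2"
      using stat \<open>\<kappa> \<ge> 0\<close> by (rule mult_left_mono)
    also have "\<dots> \<le> (norm G)\<^sup>2"
      by (rule proj_norm_sphere_bound[OF cone G \<kappa>_le])
    finally show "max (\<kappa> * (stat_measure X f r)\<^sup>2) (1 * (norm G)\<^sup>2) \<le> inner G N"
      using inner_metric_proj_cone[OF cone G] by (simp add: inner_commute)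
  next
    fix \<alpha> :: real assume "\<alpha> > 0"
    then have "\<alpha> *\<^sub>R G \<in> C" using cone G by (simp add: metric_proj_iff cone_def)
    then have "rank (\<alpha> *\<^sub>R G) \<le> r - rank X"
      using \<open>C \<subseteq> rank_le (r - rank X)\<close> by (auto simp: rank_le_def)
    then show "X + \<alpha> *\<^sub>R G \<in> rank_le r"
      using rank_add_le[of X "\<alpha> *\<^sub>R G"] \<open>rank X < r\<close> by (simp add: rank_le_def)
  qed
  then show ?thesis
    using min unfolding N_def by blast
qed

end
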